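(* Let $n$ be a natural number, let $P=\{p_1,\dots,p_k\}$ be a non-empty finite set of primes, and let $b_P=\prod_{r=1}^k p_r$. For $f\in \mathrm{FG}_n(P)$ write its diagonal entries as $f_{ii}=\prod_{r=1}^k p_r^{c^{(r)}_{ii}}$ with $c^{(r)}_{ii}\in\mathbb{Z}$, and put $$\llbracket f\rrbracket_{n,P}=\sum_{i=1}^n\sum_{r=1}^k |c^{(r)}_{ii}|+\sum_{i=1}^{n-1}\sum_{j=i+1}^n [f_{ij}]_{b_P}.$$ Then $\llbracket\cdot\rrbracket_{n,P}$ is a word metric estimate on $\mathrm{FG}_n(P)$: there is a positive real constant $J$ such that for all $f\in\mathrm{FG}_n(P)$, $$\frac1J\,\llbracket f\rrbracket_{n,P}\le |f|_{n,P}\le J\,\llbracket f\rrbracket_{n,P},$$ where $|f|_{n,P}$ is the word length of $f$ with respect to the generating set $K_P$.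
   Context: For $1\le r\le s\le n$ and $q\in\mathbb{Q}$, $\theta_{rs}(q)$ is the $n\times n$ matrix equal to $q$ at entry $(r,s)$ and equal to the identity matrix at every other entry. $U=\{\theta_{rs}(1),\theta_{rs}(1)^{-1}:1\le r<s\le n\}$, $J_P=\{\theta_{rr}(p),\theta_{rr}(p)^{-1}:p\in P,1\le r\le n\}$, $K_P=U\cup J_P$, and $\mathrm{FG}_n(P)$ is the subgroup of $GL_n(\mathbb{Q})$ generated by $K_P$. Elements of $\mathrm{FG}_n(P)$ are upper triangular, their diagonal entries are products of integer powers of the primes in $P$, and their other entries have finite base $b_P$ representation. For an integer $b>1$ and a non-zero rational $x$ with finite base $b$ representation $|x|=\sum_{i=k}^{l}\epsilon_i b^i$ (integers $k\le l$, digits $\epsilon_i\in\{0,\dots,b-1\}$, $\epsilon_k\ne0$, $\epsilon_l\neq 0$), set $[x]_b=1+\max\{|k|,|l|\}$. Also $[0]_b=0$. *)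

theory Defs
  imports
    Jordan_Normal_Form.Matrix
    "HOL-Algebra.Generated_Groups"
    "HOL-Computational_Algebra.Primes"
begin

text \<open>
  Matrices from \<open>Jordan_Normal_Form\<close> are indexed from \<open>0\<close>, so rows and columns range over
  \<open>0, \<dots>, n - 1\<close> throughout.
\<close>

definition GL_rat :: "nat \<Rightarrow> rat mat monoid" where
  "GL_rat n = units_of (ring_mat TYPE(rat) n ())"

text \<open>The exceptional entry takes precedence over the diagonal: \<open>\<theta> n r r q\<close> has \<open>q\<close> at \<open>(r, r)\<close>.\<close>

definition \<theta> :: "nat \<Rightarrow> nat \<Rightarrow> nat \<Rightarrow> rat \<Rightarrow> rat mat" where
  "\<theta> n r s q = mat n n (\<lambda>(i, j). if i = r \<and> j = s then q else if i = j then 1 else 0)"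

definition U_gens :: "nat \<Rightarrow> rat mat set" where
  "U_gens n = (\<Union>s<n. \<Union>r<s. {\<theta> n r s 1, inv\<^bsub>GL_rat n\<^esub> (\<theta> n r s 1)})"

definition J_gens :: "nat \<Rightarrow> nat set \<Rightarrow> rat mat set" where
  "J_gens n P = (\<Union>p\<in>P. \<Union>r<n. {\<theta> n r r (of_nat p), inv\<^bsub>GL_rat n\<^esub> (\<theta> n r r (of_nat p))})"

definition K_gens :: "nat \<Rightarrow> nat set \<Rightarrow> rat mat set" where
  "K_gens n P = U_gens n \<union> J_gens n P"

definition FG :: "nat \<Rightarrow> nat set \<Rightarrow> rat mat set" where
  "FG n P = generate (GL_rat n) (K_gens n P)"

text \<open>
  Word length is only meaningful on the subgroup generated by \<open>S\<close>; elsewhere \<open>LEAST\<close> is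
  unspecified.
\<close>

definition word_length :: "('a, 'b) monoid_scheme \<Rightarrow> 'a set \<Rightarrow> 'a \<Rightarrow> nat" where
  "word_length G S g =
     (LEAST m. \<exists>ws. set ws \<subseteq> S \<union> m_inv G ` S \<and> length ws = m \<and>
                    foldr (mult G) ws (one G) = g)"

definition finite_base_repr :: "nat \<Rightarrow> int \<Rightarrow> int \<Rightarrow> (int \<Rightarrow> nat) \<Rightarrow> rat \<Rightarrow> bool" where
  "finite_base_repr b k l \<epsilon> x \<longleftrightarrow>
     k \<le> l \<and> (\<forall>i\<in>{k..l}. \<epsilon> i < b) \<and> \<epsilon> k \<noteq> 0 \<and> \<epsilon> l \<noteq> 0 \<and>
     \<bar>x\<bar> = (\<Sum>i\<in>{k..l}. of_nat (\<epsilon> i) * of_nat b powi i)"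

text \<open>
  For \<open>b > 1\<close> the extremal exponents \<open>k\<close> and \<open>l\<close> of a finite base \<open>b\<close> representation are unique,
  so \<open>THE\<close> is well defined whenever \<open>x\<close> has such a representation.
\<close>

definition base_length :: "nat \<Rightarrow> rat \<Rightarrow> int" where
  "base_length b x =
     (if x = 0 then 0
      else (THE m. \<exists>k l \<epsilon>. finite_base_repr b k l \<epsilon> x \<and> m = 1 + max \<bar>k\<bar> \<bar>l\<bar>))"

text \<open>
  The exponents \<open>c\<close> in \<open>x = (\<Prod>p\<in>P. p ^ c p)\<close>; they are unique by unique factorisation once \<open>c\<close> is
  normalised to vanish off \<open>P\<close>.
\<close>

definition prime_exponents :: "nat set \<Rightarrow> rat \<Rightarrow> nat \<Rightarrow> int" where
  "prime_exponents P x =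
     (THE c. (\<forall>p. p \<notin> P \<longrightarrow> c p = 0) \<and> x = (\<Prod>p\<in>P. of_nat p powi c p))"

definition FG_estimate :: "nat \<Rightarrow> nat set \<Rightarrow> rat mat \<Rightarrow> int" where
  "FG_estimate n P f =
     (\<Sum>i<n. \<Sum>p\<in>P. \<bar>prime_exponents P (f $$ (i, i)) p\<bar>) +
     (\<Sum>i<n - 1. \<Sum>j\<in>{i + 1..<n}. base_length (\<Prod>P) (f $$ (i, j)))"

end

theory Submission
  imports Defs
begin

text \<open>
  Lower bound: multiplying by a generator scales a row by \<open>p\<close> or \<open>1 / p\<close> with \<open>p \<in> P\<close>, or adds a row
  to, or subtracts it from, an earlier one. By induction on the word, an element \<open>f\<close> of length \<open>m\<close>
  has total diagonal
  exponent at most \<open>m\<close>, and each entry \<open>x\<close> satisfies \<open>x b\<^sup>m \<in> \<int>\<close> and \<open>\<bar>x\<bar> \<le> b\<^sup>m\<close>,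
  whence \<open>[x]\<^sub>b \<le> m + 1\<close>.

  Upper bound: \<open>f\<close> is the product, in column order, of the matrices \<open>\<theta>\<^sub>i\<^sub>j(f\<^sub>i\<^sub>j)\<close>, \<open>i \<le> j\<close>.
  A diagonal factor has length at most the sum of its absolute exponents. An off-diagonal
  factor \<open>\<theta>\<^sub>i\<^sub>j(x)\<close> has length \<open>O([x]\<^sub>b)\<close>, because conjugation by \<open>\<theta>\<^sub>i\<^sub>i(b)\<close> multiplies \<open>x\<close> by \<open>b\<close>
  and so the base \<open>b\<close> digits can be produced one by one.
\<close>

section \<open>Balls for the word metric\<close>

text \<open>Length is bounded rather than prescribed, so membership both certifies a product of
  letters and bounds \<open>word_length\<close>, without reference to \<open>LEAST\<close>. Radii
  add under multiplication.\<close>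

definition word_ball :: "('a, 'b) monoid_scheme \<Rightarrow> 'a set \<Rightarrow> nat \<Rightarrow> 'a set" where
  "word_ball G S m =
     {foldr (mult G) ws (one G) | ws. set ws \<subseteq> S \<union> m_inv G ` S \<and> length ws \<le> m}"

lemma word_length_le:
  assumes "g \<in> word_ball G S m"
  shows "word_length G S g \<le> m"
proof -
  obtain ws where ws: "set ws \<subseteq> S \<union> m_inv G ` S" "length ws \<le> m"
    "foldr (mult G) ws (one G) = g"
    using assms unfolding word_ball_def by auto
  have "word_length G S g \<le> length ws"
    unfolding word_length_def by (rule Least_le) (use ws in blast)
  with ws(2) show ?thesis by simp
qed

lemma word_ball_mono: "m \<le> k \<Longrightarrow> g \<in> word_ball G S m \<Longrightarrow> g \<in> word_ball G S k"
  unfolding word_ball_def by force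

lemma one_in_word_ball: "one G \<in> word_ball G S m"
  unfolding word_ball_def by (auto intro!: exI[of _ "[]"])

context group
begin

lemma gen_in_word_ball:
  assumes "S \<subseteq> carrier G" "g \<in> S \<union> m_inv G ` S"
  shows "g \<in> word_ball G S 1"
proof -
  have "g \<in> carrier G" using assms by auto
  then show ?thesis unfolding word_ball_def using assms(2)
    by (auto intro!: exI[of _ "[g]"])
qed

lemma foldr_mult_closed:
  "set ws \<subseteq> carrier G \<Longrightarrow> foldr (\<otimes>) ws \<one> \<in> carrier G"
  by (induction ws) auto

lemma foldr_mult_append:
  "set ws \<subseteq> carrier G \<Longrightarrow> set vs \<subseteq> carrier G \<Longrightarrow>
    foldr (\<otimes>) (ws @ vs) \<one> = foldr (\<otimes>) ws \<one> \<otimes> foldr (\<otimes>) vs \<one>"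
proof (induction ws)
  case Nil
  then show ?case using foldr_mult_closed[of vs] by simp
next
  case (Cons w ws)
  then show ?case using foldr_mult_closed[of ws] foldr_mult_closed[of vs]
    by (simp add: m_assoc)
qed

lemma mult_in_word_ball:
  assumes "S \<subseteq> carrier G" "g \<in> word_ball G S m" "h \<in> word_ball G S k"
  shows "g \<otimes> h \<in> word_ball G S (m + k)"
proof -
  obtain ws where ws: "set ws \<subseteq> S \<union> m_inv G ` S" "length ws \<le> m" "foldr (\<otimes>) ws \<one> = g"
    using assms(2) unfolding word_ball_def by auto
  obtain vs where vs: "set vs \<subseteq> S \<union> m_inv G ` S" "length vs \<le> k" "foldr (\<otimes>) vs \<one> = h"
    using assms(3) unfolding word_ball_def by auto
  have "S \<union> m_inv G ` S \<subseteq> carrier G" using assms(1) by auto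
  then have "foldr (\<otimes>) (ws @ vs) \<one> = g \<otimes> h"
    using foldr_mult_append[of ws vs] ws vs by blast
  then show ?thesis unfolding word_ball_def using ws vs
    by (auto intro!: exI[of _ "ws @ vs"])
qed

text \<open>The induction over \<open>generate\<close> yields some word for \<open>g\<close>; hence
  the set of lengths under \<open>LEAST\<close> is nonempty and the minimum is attained.\<close>

lemma in_word_ball_word_length:
  assumes "S \<subseteq> carrier G" "g \<in> generate G S"
  shows "g \<in> word_ball G S (word_length G S g)"
proof -
  have "\<exists>m. g \<in> word_ball G S m"
    using assms(2)
  proof (induction rule: generate.induct)
    case one
    then show ?case using one_in_word_ball by blast
  next
    case (incl h)
    then show ?case using gen_in_word_ball[OF assms(1)] by blast
  next
    case (inv h)
    then show ?case using gen_in_word_ball[OF assms(1)] by blast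
  next
    case (eng h1 h2)
    then show ?case using mult_in_word_ball[OF assms(1)] by blast
  qed
  then obtain ws where "set ws \<subseteq> S \<union> m_inv G ` S" "foldr (\<otimes>) ws \<one> = g"
    unfolding word_ball_def by auto
  then have "\<exists>m ws. set ws \<subseteq> S \<union> m_inv G ` S \<and> length ws = m \<and> foldr (\<otimes>) ws \<one> = g"
    by blast
  from LeastI_ex[OF this] show ?thesis
    unfolding word_length_def word_ball_def by auto
qed

end

section \<open>Row operations in the general linear group\<close>

lemma GL_rat_simps:
  "mult (GL_rat n) = (*)" "one (GL_rat n) = 1\<^sub>m n"
  by (simp_all add: GL_rat_def units_of_def ring_mat_simps)

lemma group_GL_rat: "group (GL_rat n)"
proof -
  interpret ring "ring_mat TYPE(rat) n ()" by (rule ring_mat)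
  show ?thesis unfolding GL_rat_def by (rule units_group)
qed

lemma GL_ratI:
  assumes "A \<in> carrier_mat n n" "B \<in> carrier_mat n n" "A * B = 1\<^sub>m n" "B * A = 1\<^sub>m n"
  shows "A \<in> carrier (GL_rat n)" "inv\<^bsub>GL_rat n\<^esub> A = B"
proof -
  have c: "A \<in> carrier (GL_rat n)" "B \<in> carrier (GL_rat n)"
    using assms unfolding GL_rat_def units_of_def Units_def by (auto simp: ring_mat_simps)
  then show "A \<in> carrier (GL_rat n)" by simp
  interpret group "GL_rat n" by (rule group_GL_rat)
  show "inv\<^bsub>GL_rat n\<^esub> A = B" using c assms by (intro inv_equality) (auto simp: GL_rat_simps)
qed

lemma theta_carrier [simp]: "\<theta> n r s q \<in> carrier_mat n n"
  by (simp add: \<theta>_def)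

lemma theta_dim [simp]: "dim_row (\<theta> n r s q) = n" "dim_col (\<theta> n r s q) = n"
  by (simp_all add: \<theta>_def)

lemma theta_index:
  "i < n \<Longrightarrow> j < n \<Longrightarrow>
    \<theta> n r s q $$ (i, j) = (if i = r \<and> j = s then q else if i = j then 1 else 0)"
  by (simp add: \<theta>_def)

text \<open>Left multiplication by \<open>\<theta>\<close> is a row operation: row scaling if
  \<open>r = s\<close>, row addition otherwise. The matrix identities for \<open>\<theta>\<close>
  below are read off from this formula.\<close>

lemma theta_mult_index:
  assumes "A \<in> carrier_mat n n" "i < n" "j < n" "s < n"
  shows "(\<theta> n r s q * A) $$ (i, j) =
    (if i = r then (if r = s then q * A $$ (r, j) else A $$ (r, j) + q * A $$ (s, j))
     else A $$ (i, j))"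
proof -
  have "(\<theta> n r s q * A) $$ (i, j) =
      (\<Sum>k<n. (if i = r \<and> k = s then q else if i = k then 1 else 0) * A $$ (k, j))"
    using assms by (simp add: \<theta>_def scalar_prod_def lessThan_atLeast0)
  \<comment> \<open>The identity part is split from the exceptional entry. If \<open>r = s\<close>,
    that entry replaces the diagonal 1, so the identity part must vanish in row
    \<open>r\<close>.\<close>
  also have "\<dots> = (\<Sum>k<n. (if k = i then if i = r \<and> r = s then 0 else A $$ (k, j) else 0) +
      (if k = s then if i = r then q * A $$ (k, j) else 0 else 0))"
    by (rule sum.cong) auto
  also have "\<dots> = (if i = r \<and> r = s then 0 else A $$ (i, j)) +
      (if i = r then q * A $$ (s, j) else 0)"
    using assms by (simp add: sum.distrib)
  finally show ?thesis by auto
qed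

lemma theta_diag_mult: "r < n \<Longrightarrow> \<theta> n r r a * \<theta> n r r b = \<theta> n r r (a * b)"
  by (rule eq_matI) (auto simp: theta_mult_index theta_index simp del: index_mult_mat(1))

lemma theta_diag_one: "\<theta> n r r 1 = 1\<^sub>m n"
  by (rule eq_matI) (auto simp: \<theta>_def)

lemma theta_upper_mult:
  "r < n \<Longrightarrow> s < n \<Longrightarrow> r \<noteq> s \<Longrightarrow> \<theta> n r s a * \<theta> n r s b = \<theta> n r s (a + b)"
  by (rule eq_matI) (auto simp: theta_mult_index theta_index simp del: index_mult_mat(1))

lemma theta_upper_zero: "r \<noteq> s \<Longrightarrow> \<theta> n r s 0 = 1\<^sub>m n"
  by (rule eq_matI) (auto simp: \<theta>_def)

text \<open>The left factor scales row \<open>r\<close> by \<open>t\<close>; the right factor scales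
  column \<open>r\<close> by \<open>inverse t\<close>. Column \<open>r\<close> contains only the
  diagonal entry, which returns to 1.\<close>

lemma theta_conjugate:
  assumes "r < n" "s < n" "r \<noteq> s" "t \<noteq> 0"
  shows "\<theta> n r r t * (\<theta> n r s x * \<theta> n r r (inverse t)) = \<theta> n r s (t * x)"
proof (rule eq_matI)
  fix i j assume "i < dim_row (\<theta> n r s (t * x))" "j < dim_col (\<theta> n r s (t * x))"
  then have ij: "i < n" "j < n" by (auto simp: \<theta>_def)
  have "\<theta> n r s x * \<theta> n r r (inverse t) \<in> carrier_mat n n" 
    by (rule mult_carrier_mat) auto
  with ij assms show "(\<theta> n r r t * (\<theta> n r s x * \<theta> n r r (inverse t))) $$ (i, j) =
     \<theta> n r s (t * x) $$ (i, j)"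
    by (auto simp: theta_mult_index theta_index simp del: index_mult_mat(1))
qed (auto simp: \<theta>_def)

lemma theta_upper_GL:
  assumes "r < s" "s < n"
  shows "\<theta> n r s q \<in> carrier (GL_rat n)" "inv\<^bsub>GL_rat n\<^esub> (\<theta> n r s q) = \<theta> n r s (- q)"
  using GL_ratI[of "\<theta> n r s q" n "\<theta> n r s (- q)"] assms
  by (simp_all add: theta_upper_mult theta_upper_zero)

lemma theta_diag_GL:
  assumes "r < n" "q \<noteq> 0"
  shows "\<theta> n r r q \<in> carrier (GL_rat n)" "inv\<^bsub>GL_rat n\<^esub> (\<theta> n r r q) = \<theta> n r r (inverse q)"
  using GL_ratI[of "\<theta> n r r q" n "\<theta> n r r (inverse q)"] assms
  by (simp_all add: theta_diag_mult theta_diag_one)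

section \<open>The generating set\<close>

lemma K_gens_carrier:
  assumes "0 \<notin> P"
  shows "K_gens n P \<subseteq> carrier (GL_rat n)"
proof -
  interpret group "GL_rat n" by (rule group_GL_rat)
  show ?thesis
    unfolding K_gens_def U_gens_def J_gens_def using assms
    by (auto intro!: theta_upper_GL theta_diag_GL)
qed

text \<open>Inverting a generator only flips the sign of \<open>q\<close> or \<open>e\<close>, so
  the alphabet of \<open>word_length\<close>, which adjoins inverses again, consists of two kinds of
  row operation.\<close>

lemma K_gens_cases:
  assumes "0 \<notin> P" "g \<in> K_gens n P \<union> m_inv (GL_rat n) ` K_gens n P"
  obtains (upper) r s q where "r < s" "s < n" "\<bar>q\<bar> = 1" "g = \<theta> n r s q"
  | (diag) r p e where "r < n" "p \<in> P" "\<bar>e\<bar> = (1 :: int)" "g = \<theta> n r r (of_nat p powi e)"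
proof -
  have P0: "p \<noteq> 0" if "p \<in> P" for p using assms(1) that by metis
  have "(\<exists>r s q. r < s \<and> s < n \<and> \<bar>q\<bar> = 1 \<and> g = \<theta> n r s q) \<or>
     (\<exists>r p e. r < n \<and> p \<in> P \<and> \<bar>e\<bar> = (1 :: int) \<and> g = \<theta> n r r (of_nat p powi e))"
  proof -
    from assms(2) obtain h where h: "h \<in> K_gens n P" "g = h \<or> g = inv\<^bsub>GL_rat n\<^esub> h" by auto
    from h(1) consider
       (a) r s q where "r < s" "s < n" "\<bar>q\<bar> = 1" "h = \<theta> n r s q"
     | (b) r p e where "r < n" "p \<in> P" "\<bar>e\<bar> = (1 :: int)" "h = \<theta> n r r (of_nat p powi e)"
    proof (unfold K_gens_def U_gens_def J_gens_def, safe)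
      fix s r assume *: "s < n" "r < s"
      show thesis if "h = \<theta> n r s 1" by (rule a[of r s 1]) (use * that in auto)
      show thesis if "h = inv\<^bsub>GL_rat n\<^esub> (\<theta> n r s 1)"
        by (rule a[of r s "-1"]) (use * that in \<open>auto simp: theta_upper_GL\<close>)
    next
      fix p r assume *: "p \<in> P" "r < n"
      show thesis if "h = \<theta> n r r (of_nat p)" by (rule b[of r p 1]) (use * that in auto)
      show thesis if "h = inv\<^bsub>GL_rat n\<^esub> (\<theta> n r r (of_nat p))"
        by (rule b[of r p "-1"]) (use * that P0 in \<open>auto simp: theta_diag_GL power_int_minus\<close>)
    qed
    then show ?thesis
    proof cases
      case (a r s q)
      have "g = \<theta> n r s q \<or> g = \<theta> n r s (- q)"
        using h(2) unfolding a(4) theta_upper_GL(2)[OF a(1,2)] .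
      then obtain q' where "\<bar>q'\<bar> = 1 \<and> g = \<theta> n r s q'"
        using a(3) abs_minus_cancel[of q] by metis
      then show ?thesis using a(1,2) by blast
    next
      case (b r p e)
      have "(of_nat p :: rat) powi e \<noteq> 0" using P0 b(2) by (simp add: power_int_eq_0_iff)
      from theta_diag_GL(2)[OF b(1) this]
      have "g = \<theta> n r r (of_nat p powi e) \<or> g = \<theta> n r r (of_nat p powi (- e))"
        using h(2) unfolding b(4) power_int_minus by simp
      then obtain e' where "\<bar>e'\<bar> = 1 \<and> g = \<theta> n r r (of_nat p powi e')"
        using b(3) abs_minus_cancel[of e] by metis
      then show ?thesis using b(1,2) by blast
    qed
  qed
  then show thesis using upper diag by blast
qed

lemma theta_in_K_gens:
  assumes "r < s" "s < n" "\<bar>q\<bar> = 1"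
  shows "\<theta> n r s q \<in> K_gens n P"
proof -
  have "q = 1 \<or> q = -1" using assms(3) by linarith
  then show ?thesis
    using assms theta_upper_GL(2)[of r s n 1] unfolding K_gens_def U_gens_def by force
qed

lemma theta_diag_in_K_gens:
  assumes "r < n" "p \<in> P" "p \<noteq> 0"
  shows "\<theta> n r r (of_nat p) \<in> K_gens n P" "\<theta> n r r (inverse (of_nat p)) \<in> K_gens n P"
  using assms theta_diag_GL(2)[of r n "of_nat p"] unfolding K_gens_def J_gens_def by force+

section \<open>Finite base \<open>b\<close> representations\<close>

text \<open>Each digit is at most \<open>b - 1\<close>, and
  \<open>(b - 1) * b ^ i + b ^ i = b ^ (i + 1)\<close> carries the strict bound up one
  position.\<close>

lemma base_digits_less:
  fixes \<epsilon> :: "int \<Rightarrow> nat"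
  assumes "b > 1" "k \<le> l" "\<forall>i\<in>{k..l}. \<epsilon> i < b"
  shows "(\<Sum>i\<in>{k..l}. of_nat (\<epsilon> i) * of_nat b powi i) < (of_nat b :: rat) powi (l + 1)"
  using assms(2,3)
proof (induction l rule: int_ge_induct)
  case base
  have "(of_nat (\<epsilon> k) :: rat) * of_nat b powi k < of_nat b * of_nat b powi k"
    using base assms(1) by (intro mult_strict_right_mono) auto
  then show ?case using assms(1) by (simp add: power_int_add)
next
  case (step l)
  have "(of_nat (\<epsilon> (l + 1)) :: rat) \<le> of_nat (b - 1)"
  proof (rule of_nat_mono)
    have "\<epsilon> (l + 1) < b" using step(1,3) by auto
    then show "\<epsilon> (l + 1) \<le> b - 1" by simp
  qed
  then have "of_nat (\<epsilon> (l + 1)) * (of_nat b :: rat) powi (l + 1) \<le>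
      (of_nat b - 1) * of_nat b powi (l + 1)"
    using assms(1) by (intro mult_right_mono) (auto simp: of_nat_diff)
  moreover have "(\<Sum>i\<in>{k..l}. of_nat (\<epsilon> i) * of_nat b powi i) < (of_nat b :: rat) powi (l + 1)"
    using step by auto
  moreover have "{k..l + 1} = insert (l + 1) {k..l}" using step(1) by auto
  moreover have "(of_nat b :: rat) powi (l + 1 + 1) = of_nat b * of_nat b powi (l + 1)"
    using assms(1) by (subst power_int_add) auto
  ultimately show ?case by (simp add: left_diff_distrib)
qed

text \<open>The size of \<open>x\<close> alone determines the top exponent \<open>l\<close>.\<close>

lemma finite_base_repr_bounds:
  assumes "b > 1" "finite_base_repr b k l \<epsilon> x"
  shows "of_nat b powi l \<le> \<bar>x\<bar>" "\<bar>x\<bar> < of_nat b powi (l + 1)"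
proof -
  note r = assms(2)[unfolded finite_base_repr_def]
  show "\<bar>x\<bar> < of_nat b powi (l + 1)"
    using base_digits_less[of b k l \<epsilon>] r assms(1) by simp
  have "of_nat b powi l \<le> of_nat (\<epsilon> l) * (of_nat b :: rat) powi l"
    using r assms(1) by simp
  also have "\<dots> \<le> (\<Sum>i\<in>{k..l}. of_nat (\<epsilon> i) * of_nat b powi i)"
    using r by (intro member_le_sum) auto
  finally show "of_nat b powi l \<le> \<bar>x\<bar>" using r by simp
qed

lemma of_nat_powi_Ints: "0 \<le> i \<Longrightarrow> (of_nat b :: rat) powi i \<in> \<int>"
  by (simp add: power_int_def)

text \<open>Integrality determines the bottom exponent \<open>k\<close>: after a shift by
  \<open>- k - 1\<close> all digits but the lowest contribute integers, while the lowest contributes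
  \<open>\<epsilon> k / b\<close>, strictly between 0 and 1.\<close>

lemma finite_base_repr_Ints_iff:
  assumes "b > 1" "finite_base_repr b k l \<epsilon> x"
  shows "x * of_nat b powi j \<in> \<int> \<longleftrightarrow> - k \<le> j"
proof -
  note r = assms(2)[unfolded finite_base_repr_def]
  define B where "B = (of_nat b :: rat)"
  have B: "B > 1" using assms(1) by (simp add: B_def)
  have int: "(\<Sum>i\<in>A. of_nat (\<epsilon> i) * B powi i) * B powi j \<in> \<int>" if "A \<subseteq> {- j..}" for A j
  proof -
    have "(\<Sum>i\<in>A. of_nat (\<epsilon> i) * B powi i) * B powi j =
        (\<Sum>i\<in>A. of_nat (\<epsilon> i) * B powi (i + j))"
      using B by (simp add: sum_distrib_right power_int_add mult.assoc)
    moreover have "of_nat (\<epsilon> i) * B powi (i + j) \<in> \<int>" if "i \<in> A" for i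
      unfolding B_def using that \<open>A \<subseteq> _\<close> by (intro Ints_mult of_nat_powi_Ints) force+
    ultimately show ?thesis by (simp only: Ints_sum)
  qed
  have abs: "x * y \<in> \<int> \<longleftrightarrow> \<bar>x\<bar> * y \<in> \<int>" for y by (cases "x \<ge> 0") auto
  have "\<bar>x\<bar> * B powi j \<in> \<int> \<longleftrightarrow> - k \<le> j"
  proof
    assume "- k \<le> j"
    then show "\<bar>x\<bar> * B powi j \<in> \<int>" using int[of "{k..l}" j] r unfolding B_def by auto
  next
    assume *: "\<bar>x\<bar> * B powi j \<in> \<int>"
    show "- k \<le> j"
    proof (rule ccontr)
      assume "\<not> - k \<le> j"
      \<comment> \<open>Here \<open>j \<le> - k - 1\<close>, so a further nonnegative power of
        \<open>b\<close> reduces to the shift \<open>- k - 1\<close> itself.\<close>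
      then have "B powi (- k - 1 - j) \<in> \<int>" unfolding B_def by (intro of_nat_powi_Ints) simp
      with * have "(\<bar>x\<bar> * B powi j) * B powi (- k - 1 - j) \<in> \<int>" by (rule Ints_mult)
      then have "\<bar>x\<bar> * (B powi j * B powi (- k - 1 - j)) \<in> \<int>" by (simp add: mult.assoc)
      then have 1: "\<bar>x\<bar> * B powi (- k - 1) \<in> \<int>"
        using B by (subst (asm) power_int_add[symmetric]) auto
      have "{k..l} = insert k {k + 1..l}" using r by auto
      then have "\<bar>x\<bar> = of_nat (\<epsilon> k) * B powi k + (\<Sum>i\<in>{k + 1..l}. of_nat (\<epsilon> i) * B powi i)"
        using r unfolding B_def by simp
      then have "\<bar>x\<bar> * B powi (- k - 1) = of_nat (\<epsilon> k) * B powi k * B powi (- k - 1) +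
          (\<Sum>i\<in>{k + 1..l}. of_nat (\<epsilon> i) * B powi i) * B powi (- k - 1)"
        by (simp add: distrib_right)
      moreover have "(\<Sum>i\<in>{k + 1..l}. of_nat (\<epsilon> i) * B powi i) * B powi (- k - 1) \<in> \<int>"
        by (rule int) auto
      ultimately have "of_nat (\<epsilon> k) * B powi k * B powi (- k - 1) \<in> \<int>"
        using 1 Ints_diff by fastforce
      then have "of_nat (\<epsilon> k) * (B powi k * B powi (- k - 1)) \<in> \<int>" by (simp add: mult.assoc)
      moreover have "B powi k * B powi (- k - 1) = inverse B"
        using B by (subst power_int_add[symmetric]) (auto simp: power_int_minus)
      ultimately have "of_nat (\<epsilon> k) / B \<in> \<int>" by (simp add: field_simps)
      then obtain z where z: "of_nat (\<epsilon> k) / B = of_int z" by (elim Ints_cases)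
      have "0 < of_nat (\<epsilon> k) / B" "of_nat (\<epsilon> k) / B < 1"
        using r B unfolding B_def by auto
      with z show False by simp
    qed
  qed
  then show ?thesis using abs unfolding B_def by simp
qed

text \<open>The \<open>THE\<close> in \<open>base_length\<close> is justified by uniqueness of both
  extreme exponents, \<open>k\<close> by integrality and \<open>l\<close> by size.\<close>

lemma base_length_eq:
  assumes "b > 1" "finite_base_repr b k l \<epsilon> x"
  shows "base_length b x = 1 + max \<bar>k\<bar> \<bar>l\<bar>"
proof -
  have "0 < (of_nat b :: rat) powi l" using assms(1) by simp
  then have "x \<noteq> 0" using finite_base_repr_bounds(1)[OF assms] by auto
  have "k' = k \<and> l' = l" if "finite_base_repr b k' l' \<epsilon>' x" for k' l' \<epsilon>'
  proof -
    have "- k' \<le> j \<longleftrightarrow> - k \<le> j" for j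
      using finite_base_repr_Ints_iff[OF assms(1) that] finite_base_repr_Ints_iff[OF assms] by simp
    from this[of "- k"] this[of "- k'"] have "k' = k" by simp
    have mono: "i < j" if "(of_nat b :: rat) powi i < of_nat b powi j" for i j
    proof (rule ccontr)
      assume "\<not> i < j"
      then have "(of_nat b :: rat) powi j \<le> of_nat b powi i"
        using assms(1) by (intro power_int_increasing) auto
      with that show False by simp
    qed
    \<comment> \<open>\<open>\<bar>x\<bar>\<close> lies in one half-open interval from
      \<open>b powi l\<close> to \<open>b powi (l + 1)\<close>, and these are disjoint for different
      \<open>l\<close>.\<close>
    note 1 = finite_base_repr_bounds[OF assms] and 2 = finite_base_repr_bounds[OF assms(1) that]
    have "of_nat b powi l < (of_nat b :: rat) powi (l' + 1)" using 1 2 by linarith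
    then have "l < l' + 1" by (rule mono)
    moreover have "of_nat b powi l' < (of_nat b :: rat) powi (l + 1)" using 1 2 by linarith
    then have "l' < l + 1" by (rule mono)
    ultimately show ?thesis using \<open>k' = k\<close> by simp
  qed
  then have "(THE m. \<exists>k l \<epsilon>. finite_base_repr b k l \<epsilon> x \<and> m = 1 + max \<bar>k\<bar> \<bar>l\<bar>) =
      1 + max \<bar>k\<bar> \<bar>l\<bar>"
    using assms(2) by (intro the_equality) blast+
  with \<open>x \<noteq> 0\<close> show ?thesis unfolding base_length_def by simp
qed

text \<open>A digit-free substitute for a bound on \<open>base_length\<close>: one \<open>m\<close>
  controls both denominator and size, and sums and products are easily estimated.\<close>

definition base_bounded :: "nat \<Rightarrow> nat \<Rightarrow> rat \<Rightarrow> bool" where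
  "base_bounded b m x \<longleftrightarrow> x * of_nat b ^ m \<in> \<int> \<and> \<bar>x\<bar> \<le> of_nat b ^ m"

lemma base_digits_sum:
  fixes N :: nat
  assumes "N < b ^ m"
  shows "N = (\<Sum>i<m. N div b ^ i mod b * b ^ i)"
  using assms
proof (induction m arbitrary: N)
  case (Suc m)
  have b: "N div b < b ^ m" using Suc(2) by (simp add: less_mult_imp_div_less mult.commute)
  have "N = N mod b + N div b * b" by simp
  also have "N div b = (\<Sum>i<m. N div b div b ^ i mod b * b ^ i)" by (rule Suc(1)[OF b])
  also have "N mod b + \<dots> * b = (\<Sum>i<Suc m. N div b ^ i mod b * b ^ i)"
  proof -
    have "(N div b div b ^ i mod b * b ^ i) * b = N div b ^ Suc i mod b * b ^ Suc i" for i
      by (simp add: div_mult2_eq)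
    then show ?thesis
      unfolding sum.lessThan_Suc_shift sum_distrib_right by (simp only: power_0 div_by_1 mult_1_right)
  qed
  finally show ?case .
qed simp

text \<open>Up to sign, \<open>x * b ^ m\<close> is a natural number \<open>N\<close>; the digits of
  \<open>N\<close>, shifted down by \<open>m\<close> places and trimmed of outer zeros, represent
  \<open>x\<close>.\<close>

lemma finite_base_repr_exists:
  assumes "b > 1" "base_bounded b m x" "x \<noteq> 0"
  obtains k l \<epsilon> where "finite_base_repr b k l \<epsilon> x" "- int m \<le> k" "l \<le> int m"
proof -
  define B where "B = (of_nat b :: rat)"
  have B: "B > 1" using assms(1) by (simp add: B_def)
  have "\<bar>x * B ^ m\<bar> \<in> \<int>" using assms(2) unfolding base_bounded_def B_def by auto
  then have "\<bar>x\<bar> * B ^ m \<in> \<nat>" using B by (simp add: Nats_altdef2 abs_mult)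
  then obtain N where N: "\<bar>x\<bar> * B ^ m = of_nat N" by (elim Nats_cases)
  have "(of_nat N :: rat) \<le> B ^ m * B ^ m"
    using assms(2) B unfolding N[symmetric] base_bounded_def B_def by (intro mult_right_mono) auto
  \<comment> \<open>\<open>N\<close> may equal \<open>b ^ (2 * m)\<close>, so
    \<open>2 * m + 1\<close> digits are required; shifted by \<open>m\<close>, they occupy exactly
    the exponents from \<open>- m\<close> to \<open>m\<close>.\<close>
  also have "\<dots> < B ^ (2 * m + 1)" using B by (simp add: power_add mult_2)
  also have "\<dots> = of_nat (b ^ (2 * m + 1))" by (simp add: B_def)
  finally have "N < b ^ (2 * m + 1)" using of_nat_less_iff by blast
  from base_digits_sum[OF this]
  have "of_nat N = (of_nat (\<Sum>i<2 * m + 1. N div b ^ i mod b * b ^ i) :: rat)" by metis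
  then have Ns: "of_nat N = (\<Sum>i<2 * m + 1. of_nat (N div b ^ i mod b) * B ^ i)"
    by (simp add: B_def)
  define \<epsilon> where "\<epsilon> i = N div b ^ nat (i + int m) mod b" for i
  have "\<bar>x\<bar> = of_nat N * B powi (- int m)"
    using B by (simp add: N[symmetric] power_int_minus field_simps)
  also have "\<dots> = (\<Sum>i<2 * m + 1. of_nat (\<epsilon> (int i - int m)) * B powi (int i - int m))"
    unfolding Ns sum_distrib_right
  proof (rule sum.cong)
    fix i
    have "B powi (int i - int m) = B ^ i * B powi (- int m)"
      using B power_int_add[of B "int i" "- int m"] by simp
    then show "of_nat (N div b ^ i mod b) * B ^ i * B powi (- int m) =
        of_nat (\<epsilon> (int i - int m)) * B powi (int i - int m)"
      by (simp add: \<epsilon>_def)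
  qed simp
  also have "\<dots> = (\<Sum>i\<in>{- int m..int m}. of_nat (\<epsilon> i) * B powi i)"
    by (rule sum.reindex_bij_witness[of _ "\<lambda>i. nat (i + int m)" "\<lambda>i. int i - int m"]) auto
  finally have x: "\<bar>x\<bar> = (\<Sum>i\<in>{- int m..int m}. of_nat (\<epsilon> i) * B powi i)" .
  \<comment> \<open>A representation must begin and end with nonzero digits, so the window is cut
    down to the extreme members of \<open>S\<close>.\<close>
  define S where "S = {i \<in> {- int m..int m}. \<epsilon> i \<noteq> 0}"
  have fin: "finite S" by (rule finite_subset[of _ "{- int m..int m}"]) (auto simp: S_def)
  have "S \<noteq> {}"
  proof
    assume "S = {}"
    then have "\<bar>x\<bar> = 0" unfolding x by (intro sum.neutral) (auto simp: S_def)
    with assms(3) show False by simp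
  qed
  with fin have mm: "Min S \<in> S" "Max S \<in> S" by auto
  have "\<bar>x\<bar> = (\<Sum>i\<in>{Min S..Max S}. of_nat (\<epsilon> i) * B powi i)"
    unfolding x
  proof (rule sum.mono_neutral_right)
    show "{Min S..Max S} \<subseteq> {- int m..int m}" using mm unfolding S_def by auto
    show "\<forall>i\<in>{- int m..int m} - {Min S..Max S}. of_nat (\<epsilon> i) * B powi i = 0"
    proof
      fix i assume i: "i \<in> {- int m..int m} - {Min S..Max S}"
      then have "i \<notin> S" using Min_le[OF fin, of i] Max_ge[OF fin, of i] by auto
      then show "of_nat (\<epsilon> i) * B powi i = 0" using i unfolding S_def by auto
    qed
  qed simp
  then have "finite_base_repr b (Min S) (Max S) \<epsilon> x"
    unfolding finite_base_repr_def using mm assms(1) Min_le[OF fin mm(2)]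
    by (auto simp: S_def B_def \<epsilon>_def)
  then show thesis using that mm unfolding S_def by auto
qed

lemma base_length_le:
  assumes "b > 1" "base_bounded b m x"
  shows "base_length b x \<le> 1 + int m"
proof (cases "x = 0")
  case False
  obtain k l \<epsilon> where r: "finite_base_repr b k l \<epsilon> x" "- int m \<le> k" "l \<le> int m"
    using finite_base_repr_exists[OF assms False] .
  then have "\<bar>k\<bar> \<le> int m" "\<bar>l\<bar> \<le> int m" unfolding finite_base_repr_def by linarith+
  then show ?thesis using base_length_eq[OF assms(1) r(1)] by simp
qed (simp add: base_length_def)

lemma base_length_pos:
  assumes "b > 1" "base_bounded b m x" "x \<noteq> 0"
  shows "0 < base_length b x"
proof -
  obtain k l \<epsilon> where r: "finite_base_repr b k l \<epsilon> x"
    using finite_base_repr_exists[OF assms] .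
  show ?thesis unfolding base_length_eq[OF assms(1) r] by simp
qed

text \<open>The given bound guarantees that a finite representation exists; the conclusion replaces
  the arbitrary \<open>m\<close> by the length of \<open>x\<close>.\<close>

lemma base_bounded_base_length:
  assumes "b > 1" "base_bounded b m x"
  shows "base_bounded b (nat (base_length b x)) x"
proof (cases "x = 0")
  case False
  obtain k l \<epsilon> where r: "finite_base_repr b k l \<epsilon> x"
    using finite_base_repr_exists[OF assms False] .
  define M where "M = nat (base_length b x)"
  have M: "int M = 1 + max \<bar>k\<bar> \<bar>l\<bar>" unfolding M_def base_length_eq[OF assms(1) r] by simp
  have "x * of_nat b powi (int M) \<in> \<int>"
    unfolding finite_base_repr_Ints_iff[OF assms(1) r] using M by linarith
  \<comment> \<open>The summand 1 in \<open>base_length\<close> absorbs the exponent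
    \<open>l + 1\<close> of the upper bound for \<open>\<bar>x\<bar>\<close>.\<close>
  moreover have "(of_nat b :: rat) powi (l + 1) \<le> of_nat b powi (int M)"
    using M assms(1) by (intro power_int_increasing) auto
  then have "\<bar>x\<bar> \<le> of_nat b powi (int M)"
    using finite_base_repr_bounds(2)[OF assms(1) r] by linarith
  ultimately show ?thesis unfolding base_bounded_def M_def[symmetric] by simp
qed (simp add: base_bounded_def)

section \<open>Uniqueness of prime exponents\<close>

text \<open>If \<open>c q\<close> exceeded \<open>d q\<close>, clearing negative powers in the
  quotient would give two equal natural products, the left one divisible by \<open>q\<close>. On the
  right \<open>q\<close> could only divide a power of itself, but there its exponent is 0. Equality
  follows by exchanging \<open>c\<close> and \<open>d\<close>.\<close>

lemma prime_exponents_unique: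
  fixes c d :: "nat \<Rightarrow> int"
  assumes "finite P" "\<And>p. p \<in> P \<Longrightarrow> prime p"
    and "(\<Prod>p\<in>P. (of_nat p :: rat) powi c p) = (\<Prod>p\<in>P. of_nat p powi d p)" "q \<in> P"
  shows "c q \<le> d q"
proof (rule ccontr)
  assume *: "\<not> c q \<le> d q"
  have nz: "(of_nat p :: rat) \<noteq> 0" if "p \<in> P" for p using assms(2)[OF that] by auto
  define e where "e p = c p - d p" for p
  have "(\<Prod>p\<in>P. (of_nat p :: rat) powi e p) = 1"
  proof -
    have "(\<Prod>p\<in>P. (of_nat p :: rat) powi e p) =
        (\<Prod>p\<in>P. of_nat p powi c p / of_nat p powi d p)"
      using nz by (intro prod.cong) (auto simp: e_def power_int_diff)
    also have "\<dots> = 1"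
    proof -
      have "(\<Prod>p\<in>P. (of_nat p :: rat) powi d p) \<noteq> 0"
        using assms(1) nz unfolding prod_zero_iff[OF assms(1)] by (simp only: power_int_eq_0_iff) blast
      then show ?thesis unfolding prod_dividef assms(3) by simp
    qed
    finally show ?thesis .
  qed
  \<comment> \<open>At least one of \<open>nat (e p)\<close> and \<open>nat (- e p)\<close> is 0, so
    this moves negative exponents into the denominator.\<close>
  moreover have "(of_nat p :: rat) powi e p = of_nat p ^ nat (e p) / of_nat p ^ nat (- e p)"
    for p by (cases "e p \<ge> 0") (auto simp: power_int_def field_simps)
  ultimately have "(\<Prod>p\<in>P. (of_nat p :: rat) ^ nat (e p)) = (\<Prod>p\<in>P. of_nat p ^ nat (- e p))"
    using assms(1) nz by (simp add: prod_dividef)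
  then have "of_nat (\<Prod>p\<in>P. p ^ nat (e p)) = (of_nat (\<Prod>p\<in>P. p ^ nat (- e p)) :: rat)" by simp
  then have eq: "(\<Prod>p\<in>P. p ^ nat (e p)) = (\<Prod>p\<in>P. p ^ nat (- e p))" by (simp only: of_nat_eq_iff)
  have q: "prime q" using assms by blast
  have "q dvd q ^ nat (e q)" using * by (simp add: e_def)
  also have "q ^ nat (e q) dvd (\<Prod>p\<in>P. p ^ nat (e p))" using assms(1,4) by (rule dvd_prodI)
  finally obtain p where p: "p \<in> P" "q dvd p ^ nat (- e p)"
    unfolding eq using prime_dvd_prod_iff[OF assms(1) q] by auto
  then have "q dvd p" using prime_dvd_power[OF q] by blast
  then have "q = p" using primes_dvd_imp_eq[OF q] assms(2) p(1) by blast
  with p(2) * q show False by (simp add: e_def)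
qed

lemma prime_exponents_eq:
  assumes "finite P" "\<And>p. p \<in> P \<Longrightarrow> prime p" "\<And>p. p \<notin> P \<Longrightarrow> c p = 0"
  shows "prime_exponents P (\<Prod>p\<in>P. of_nat p powi c p) = c"
  unfolding prime_exponents_def
proof (rule the_equality)
  fix d :: "nat \<Rightarrow> int"
  assume d: "(\<forall>p. p \<notin> P \<longrightarrow> d p = 0) \<and>
     (\<Prod>p\<in>P. (of_nat p :: rat) powi c p) = (\<Prod>p\<in>P. of_nat p powi d p)"
  show "d = c"
  proof
    fix p
    show "d p = c p"
    proof (cases "p \<in> P")
      case True
      from d have eq: "(\<Prod>p\<in>P. (of_nat p :: rat) powi c p) = (\<Prod>p\<in>P. of_nat p powi d p)" ..
      from prime_exponents_unique[OF assms(1,2) eq True]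
        prime_exponents_unique[OF assms(1,2) eq[symmetric] True]
      show ?thesis by simp
    next
      case False
      then show ?thesis using d assms(3) by simp
    qed
  qed
qed (use assms(3) in auto)

section \<open>Arithmetic of bounded entries\<close>

lemma base_bounded_mult:
  assumes "base_bounded b k x" "base_bounded b m y"
  shows "base_bounded b (k + m) (x * y)"
proof -
  have "x * y * of_nat b ^ (k + m) = (x * of_nat b ^ k) * (y * of_nat b ^ m)"
    by (simp add: power_add)
  moreover have "\<bar>x * y\<bar> \<le> of_nat b ^ k * of_nat b ^ m"
    using assms unfolding abs_mult base_bounded_def by (intro mult_mono) auto
  moreover have "(x * of_nat b ^ k) * (y * of_nat b ^ m) \<in> \<int>"
    using assms Ints_mult[of "x * of_nat b ^ k" "y * of_nat b ^ m"] unfolding base_bounded_def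
    by blast
  ultimately show ?thesis unfolding base_bounded_def power_add by (simp only: simp_thms)
qed

text \<open>A single extra power of \<open>b\<close> suffices because
  \<open>2 \<le> b\<close>.\<close>

lemma base_bounded_add:
  assumes "b > 1" "base_bounded b m x" "base_bounded b m y"
  shows "base_bounded b (Suc m) (x + y)"
proof -
  have "(x + y) * of_nat b ^ Suc m = of_nat b * (x * of_nat b ^ m + y * of_nat b ^ m)"
    by (simp add: algebra_simps)
  moreover have "of_nat b * (x * of_nat b ^ m + y * of_nat b ^ m) \<in> \<int>"
    using assms unfolding base_bounded_def
    by (intro Ints_mult[OF Ints_of_nat Ints_add]) simp_all
  moreover have "2 * (of_nat b :: rat) ^ m \<le> of_nat b * of_nat b ^ m"
    using assms(1) by (intro mult_right_mono) auto
  then have "\<bar>x + y\<bar> \<le> of_nat b ^ Suc m"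
    using assms unfolding base_bounded_def power_Suc by linarith
  ultimately show ?thesis unfolding base_bounded_def by (simp only: simp_thms)
qed

lemma base_bounded_of_int: "b > 0 \<Longrightarrow> \<bar>x\<bar> \<le> 1 \<Longrightarrow> base_bounded b m (of_int x)"
proof -
  assume "b > 0" "\<bar>x\<bar> \<le> 1"
  then have "\<bar>of_int x :: rat\<bar> \<le> 1" "1 \<le> (of_nat b :: rat) ^ m"
    by (simp_all flip: of_int_abs)
  then show "base_bounded b m (of_int x)" unfolding base_bounded_def by auto
qed

lemma base_bounded_mono:
  assumes "b > 0" "m \<le> k" "base_bounded b m x"
  shows "base_bounded b k x"
  \<comment> \<open>\<open>x\<close> is regarded as \<open>1 * x\<close>, where 1 is bounded with
    exponent \<open>k - m\<close>.\<close>
  using base_bounded_mult[OF base_bounded_of_int[OF assms(1), of 1 "k - m"] assms(3)] assms(2)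
  by simp

section \<open>Lower bound for the word length\<close>

locale prime_base =
  fixes n :: nat and P :: "nat set"
  assumes finite_P: "finite P" and P_nonempty: "P \<noteq> {}" and prime_P: "p \<in> P \<Longrightarrow> prime p"
begin

abbreviation ball :: "nat \<Rightarrow> rat mat set" where
  "ball \<equiv> word_ball (GL_rat n) (K_gens n P)"

abbreviation b :: nat where
  "b \<equiv> \<Prod>P"

lemma zero_notin_P: "0 \<notin> P"
  using prime_P not_prime_0 by blast

lemma b_pos: "0 < b"
  using zero_notin_P by (intro prod_pos) (metis gr0I)

lemma P_le_b: "p \<in> P \<Longrightarrow> p \<le> b"
  using finite_P b_pos by (intro dvd_imp_le) (auto intro: dvd_prodI[where f = "\<lambda>p. p"])

lemma b_gt_1: "1 < b"
proof -
  obtain p where "p \<in> P" using P_nonempty by blast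
  with P_le_b[OF this] prime_gt_1_nat[OF prime_P[OF this]] show ?thesis by simp
qed

lemma mult_in_ball: "g \<in> ball m \<Longrightarrow> h \<in> ball k \<Longrightarrow> g * h \<in> ball (m + k)"
  using group.mult_in_word_ball[OF group_GL_rat K_gens_carrier[OF zero_notin_P]]
  by (metis GL_rat_simps(1))

lemma one_in_ball: "1\<^sub>m n \<in> ball m"
  using one_in_word_ball[of "GL_rat n"] by (simp add: GL_rat_simps)

lemma gen_in_ball: "g \<in> K_gens n P \<Longrightarrow> g \<in> ball 1"
  using group.gen_in_word_ball[OF group_GL_rat K_gens_carrier[OF zero_notin_P]] by blast

text \<open>The invariant for the induction on words. The exponents \<open>c\<close> vanish off
  \<open>P\<close> so that they agree with the normalised choice in
  \<open>prime_exponents\<close>.\<close>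

definition word_bounds :: "nat \<Rightarrow> rat mat \<Rightarrow> bool" where
  "word_bounds m f \<longleftrightarrow> f \<in> carrier_mat n n \<and>
     (\<forall>i<n. \<forall>j<i. f $$ (i, j) = 0) \<and>
     (\<forall>i<n. \<forall>j<n. base_bounded b m (f $$ (i, j))) \<and>
     (\<exists>c. (\<forall>i p. p \<notin> P \<longrightarrow> c i p = 0) \<and>
        (\<forall>i<n. f $$ (i, i) = (\<Prod>p\<in>P. of_nat p powi c i p)) \<and>
        (\<Sum>i<n. \<Sum>p\<in>P. \<bar>c i p\<bar>) \<le> int m)"

text \<open>Only row \<open>r\<close> changes, by adding plus or minus row \<open>s\<close>; a sum
  of two bounded entries costs one more power of \<open>b\<close>. Since \<open>r < s\<close> and
  \<open>f\<close> is upper triangular, the diagonal is unaffected.\<close>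

lemma word_bounds_upper:
  assumes "word_bounds m f" "r < s" "s < n" "\<bar>q\<bar> = 1"
  shows "word_bounds (Suc m) (\<theta> n r s q * f)"
proof -
  note f = assms(1)[unfolded word_bounds_def]
  have fc: "f \<in> carrier_mat n n" using f by blast
  have q: "base_bounded b 0 q"
    using assms(4) base_bounded_of_int[OF b_pos, of 1 0] base_bounded_of_int[OF b_pos, of "-1" 0]
    by (cases "q \<ge> 0") auto
  have idx: "(\<theta> n r s q * f) $$ (i, j) =
      (if i = r then f $$ (r, j) + q * f $$ (s, j) else f $$ (i, j))" if "i < n" "j < n" for i j
    using theta_mult_index[OF fc that assms(3), of r q] assms(2) by simp
  show ?thesis
    unfolding word_bounds_def
  proof (intro conjI allI impI)
    show "\<theta> n r s q * f \<in> carrier_mat n n" using fc by (intro mult_carrier_mat) auto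
    show "(\<theta> n r s q * f) $$ (i, j) = 0" if "i < n" "j < i" for i j
      using that f assms(2,3) idx[of i j] by auto
    show "base_bounded b (Suc m) ((\<theta> n r s q * f) $$ (i, j))" if "i < n" "j < n" for i j
    proof (cases "i = r")
      case True
      have "base_bounded b (0 + m) (q * f $$ (s, j))"
        using f that assms(3) by (intro base_bounded_mult q) blast
      then show ?thesis
        using f that True by (auto simp: idx intro!: base_bounded_add b_gt_1)
    next
      case False
      have "base_bounded b m (f $$ (i, j))" using f that by blast
      then show ?thesis using False base_bounded_mono[OF b_pos, of m "Suc m"] that
        by (simp add: idx)
    qed
    obtain c where c: "\<forall>i p. p \<notin> P \<longrightarrow> c i p = 0"
      "\<forall>i<n. f $$ (i, i) = (\<Prod>p\<in>P. of_nat p powi c i p)"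
      "(\<Sum>i<n. \<Sum>p\<in>P. \<bar>c i p\<bar>) \<le> int m"
      using f by blast
    have "(\<theta> n r s q * f) $$ (i, i) = f $$ (i, i)" if "i < n" for i
      using f assms(2,3) idx[of i i] that by auto
    then show "\<exists>c. (\<forall>i p. p \<notin> P \<longrightarrow> c i p = 0) \<and>
        (\<forall>i<n. (\<theta> n r s q * f) $$ (i, i) = (\<Prod>p\<in>P. of_nat p powi c i p)) \<and>
        (\<Sum>i<n. \<Sum>p\<in>P. \<bar>c i p\<bar>) \<le> int (Suc m)"
      using c by (intro exI[of _ c]) auto
  qed
qed

text \<open>Since \<open>p\<close> divides \<open>b\<close>, one power of \<open>b\<close> clears
  the denominator of \<open>1 / p\<close>; it also bounds \<open>p\<close> itself.\<close>

lemma base_bounded_prime_powi: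
  assumes "p \<in> P" "\<bar>e\<bar> = (1 :: int)"
  shows "base_bounded b 1 (of_nat p powi e)"
proof -
  have p: "1 \<le> p" using prime_ge_1_nat[OF prime_P[OF assms(1)]] .
  obtain k where k: "b = p * k"
    using dvd_prodI[OF finite_P assms(1), of "\<lambda>p. p"] by (auto elim: dvdE)
  consider "e = 1" | "e = -1" using assms(2) by linarith
  then show ?thesis
  proof cases
    case 1
    have "(of_nat p :: rat) \<le> of_nat b" using P_le_b[OF assms(1)] of_nat_mono by blast
    moreover have "(of_nat p :: rat) * of_nat b \<in> \<int>" by (intro Ints_mult Ints_of_nat)
    ultimately show ?thesis using 1 unfolding base_bounded_def by simp
  next
    case 2
    have "inverse (of_nat p) * (of_nat b :: rat) = of_nat k" unfolding k using p by simp
    moreover have "inverse (of_nat p) \<le> (1 :: rat)" using p by (simp add: field_simps)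
    moreover have "(1 :: rat) \<le> of_nat b" using b_gt_1 by linarith
    ultimately show ?thesis unfolding base_bounded_def 2 by (simp add: power_int_minus)
  qed
qed

lemma word_bounds_diag:
  assumes "word_bounds m f" "r < n" "p \<in> P" "\<bar>e\<bar> = (1 :: int)"
  shows "word_bounds (Suc m) (\<theta> n r r (of_nat p powi e) * f)"
proof -
  note f = assms(1)[unfolded word_bounds_def]
  let ?g = "\<theta> n r r (of_nat p powi e) * f"
  have fc: "f \<in> carrier_mat n n" using f by blast
  have idx: "?g $$ (i, j) = (if i = r then of_nat p powi e * f $$ (r, j) else f $$ (i, j))"
    if "i < n" "j < n" for i j
    using theta_mult_index[OF fc that assms(2)] by simp
  show ?thesis
    unfolding word_bounds_def
  proof (intro conjI allI impI)
    show "?g \<in> carrier_mat n n" using fc by (intro mult_carrier_mat) auto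
    show "?g $$ (i, j) = 0" if "i < n" "j < i" for i j
      using that f idx[of i j] by auto
    show "base_bounded b (Suc m) (?g $$ (i, j))" if "i < n" "j < n" for i j
    proof -
      have fij: "base_bounded b m (f $$ (i, j))" using f that by blast
      show ?thesis
        using base_bounded_mult[OF base_bounded_prime_powi[OF assms(3,4)] fij]
          base_bounded_mono[OF b_pos _ fij, of "Suc m"] by (auto simp: idx[OF that])
    qed
    obtain c where c: "\<forall>i p. p \<notin> P \<longrightarrow> c i p = 0"
      "\<forall>i<n. f $$ (i, i) = (\<Prod>p\<in>P. of_nat p powi c i p)"
      "(\<Sum>i<n. \<Sum>p\<in>P. \<bar>c i p\<bar>) \<le> int m"
      using f by blast
    \<comment> \<open>Scaling row \<open>r\<close> changes a single exponent, that of
      \<open>p\<close> in the entry \<open>(r, r)\<close>, by plus or minus one.\<close>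
    define d where "d i q = c i q + (if i = r then if q = p then e else 0 else 0)" for i q
    have "d i q = 0" if "q \<notin> P" for i q using c(1) that assms(3) by (auto simp: d_def)
    moreover have "?g $$ (i, i) = (\<Prod>p\<in>P. of_nat p powi d i p)" if "i < n" for i
    proof (cases "i = r")
      case True
      have "(\<Prod>q\<in>P. (of_nat q :: rat) powi d i q) =
          (\<Prod>q\<in>P. of_nat q powi c i q * (if q = p then of_nat p powi e else 1))"
      proof (rule prod.cong)
        fix q assume "q \<in> P"
        then have "(of_nat q :: rat) \<noteq> 0" using zero_notin_P by (metis of_nat_eq_0_iff)
        then show "(of_nat q :: rat) powi d i q =
            of_nat q powi c i q * (if q = p then of_nat p powi e else 1)"
          using True by (simp add: d_def power_int_add)
      qed simp
      also have "\<dots> = (\<Prod>q\<in>P. of_nat q powi c i q) * of_nat p powi e"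
        using finite_P assms(3) by (simp add: prod.distrib)
      finally show ?thesis using c(2) that True idx[of r r] by simp
    next
      case False
      then show ?thesis using c(2) that by (simp add: idx d_def)
    qed
    moreover have "(\<Sum>i<n. \<Sum>q\<in>P. \<bar>d i q\<bar>) \<le> int (Suc m)"
    proof -
      have "(\<Sum>q\<in>P. \<bar>d i q\<bar>) \<le> (\<Sum>q\<in>P. \<bar>c i q\<bar>) + (if i = r then 1 else 0)" for i
      proof -
        have "(\<Sum>q\<in>P. \<bar>d i q\<bar>) \<le>
            (\<Sum>q\<in>P. \<bar>c i q\<bar> + (if q = p then if i = r then 1 else 0 else 0))"
          using assms(4) by (intro sum_mono) (auto simp: d_def)
        also have "\<dots> = (\<Sum>q\<in>P. \<bar>c i q\<bar>) + (if i = r then 1 else 0)"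
          using finite_P assms(3) by (simp add: sum.distrib)
        finally show ?thesis .
      qed
      then have "(\<Sum>i<n. \<Sum>q\<in>P. \<bar>d i q\<bar>) \<le>
          (\<Sum>i<n. (\<Sum>q\<in>P. \<bar>c i q\<bar>) + (if i = r then 1 else 0))"
        by (intro sum_mono) blast
      also have "\<dots> = (\<Sum>i<n. \<Sum>q\<in>P. \<bar>c i q\<bar>) + 1"
        using assms(2) by (simp add: sum.distrib)
      finally show ?thesis using c(3) by simp
    qed
    ultimately show "\<exists>c. (\<forall>i p. p \<notin> P \<longrightarrow> c i p = 0) \<and>
        (\<forall>i<n. ?g $$ (i, i) = (\<Prod>p\<in>P. of_nat p powi c i p)) \<and>
        (\<Sum>i<n. \<Sum>p\<in>P. \<bar>c i p\<bar>) \<le> int (Suc m)"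
      by (intro exI[of _ d]) blast
  qed
qed

lemma word_bounds_one: "word_bounds 0 (1\<^sub>m n)"
  unfolding word_bounds_def
  using base_bounded_of_int[OF b_pos, of 1 0] base_bounded_of_int[OF b_pos, of 0 0]
  by (auto intro!: exI[of _ "\<lambda>_ _. 0"])

lemma word_bounds_mono: "m \<le> k \<Longrightarrow> word_bounds m f \<Longrightarrow> word_bounds k f"
  unfolding word_bounds_def using base_bounded_mono[OF b_pos, of m k]
  by (smt (verit) of_nat_le_iff)

text \<open>\<open>foldr\<close> puts each new letter on the left, where it acts as a row operation
  and raises the bound by one.\<close>

lemma word_bounds_ball:
  assumes "f \<in> ball m"
  shows "word_bounds m f"
proof -
  obtain ws where ws: "set ws \<subseteq> K_gens n P \<union> m_inv (GL_rat n) ` K_gens n P" "length ws \<le> m"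
    "f = foldr (*) ws (1\<^sub>m n)"
    using assms unfolding word_ball_def by (auto simp: GL_rat_simps)
  have "word_bounds (length ws) (foldr (*) ws (1\<^sub>m n))"
    using ws(1)
  proof (induction ws)
    case Nil
    then show ?case by (simp add: word_bounds_one)
  next
    case (Cons w ws)
    then have IH: "word_bounds (length ws) (foldr (*) ws (1\<^sub>m n))"
      and w: "w \<in> K_gens n P \<union> m_inv (GL_rat n) ` K_gens n P" by auto
    from K_gens_cases[OF zero_notin_P w] show ?case
      by (cases; simp add: word_bounds_upper[OF IH] word_bounds_diag[OF IH])
  qed
  with ws show ?thesis using word_bounds_mono by blast
qed

lemma estimate_le:
  assumes "f \<in> ball m"
  shows "FG_estimate n P f \<le> (1 + 2 * int n * int n) * int m"
proof -
  note f = word_bounds_ball[OF assms, unfolded word_bounds_def]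
  obtain c where c: "\<forall>i p. p \<notin> P \<longrightarrow> c i p = 0"
    "\<forall>i<n. f $$ (i, i) = (\<Prod>p\<in>P. of_nat p powi c i p)"
    "(\<Sum>i<n. \<Sum>p\<in>P. \<bar>c i p\<bar>) \<le> int m"
    using f by blast
  have "prime_exponents P (f $$ (i, i)) = c i" if "i < n" for i
    using c that prime_exponents_eq[OF finite_P prime_P, of "c i"] by simp
  then have diag: "(\<Sum>i<n. \<Sum>p\<in>P. \<bar>prime_exponents P (f $$ (i, i)) p\<bar>) \<le> int m"
    using c(3) by simp
  have entry: "base_length b (f $$ (i, j)) \<le> 2 * int m" if "i < j" "j < n" for i j
  \<comment> \<open>The general bound \<open>1 + m\<close> is at most \<open>2 * m\<close> only for
    positive \<open>m\<close>. For \<open>m = 0\<close> the matrix is the identity, whose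
    off-diagonal entries have length 0.\<close>
  proof (cases "m = 0")
    case True
    then have "f = 1\<^sub>m n" using assms unfolding word_ball_def by (auto simp: GL_rat_simps)
    then show ?thesis using that True by (simp add: base_length_def)
  next
    case False
    have "base_bounded b m (f $$ (i, j))" using f that by auto
    from base_length_le[OF b_gt_1 this] False show ?thesis by simp
  qed
  have "(\<Sum>i<n - 1. \<Sum>j\<in>{i + 1..<n}. base_length b (f $$ (i, j))) \<le>
      (\<Sum>i<n - 1. \<Sum>j\<in>{i + 1..<n}. 2 * int m)"
    by (intro sum_mono entry) auto
  also have "\<dots> \<le> (\<Sum>i<n - 1. int n * (2 * int m))"
    by (intro sum_mono) (auto intro!: mult_right_mono)
  also have "\<dots> = int (n - 1) * (int n * (2 * int m))" by simp
  also have "\<dots> \<le> int n * (int n * (2 * int m))" by (intro mult_right_mono) auto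
  finally show ?thesis using diag unfolding FG_estimate_def by (simp add: algebra_simps)
qed

section \<open>Word length of elementary factors\<close>

lemma theta_diag_power_in_ball:
  assumes "r < n" "\<theta> n r r x \<in> ball a"
  shows "\<theta> n r r (x ^ k) \<in> ball (k * a)"
proof (induction k)
  case 0
  then show ?case by (simp add: theta_diag_one one_in_ball)
next
  case (Suc k)
  from mult_in_ball[OF assms(2) Suc] show ?case by (simp add: theta_diag_mult[OF assms(1)])
qed

lemma theta_diag_prime_in_ball:
  assumes "r < n" "p \<in> P"
  shows "\<theta> n r r (of_nat p powi c) \<in> ball (nat \<bar>c\<bar>)"
proof -
  have "p \<noteq> 0" using assms(2) zero_notin_P by metis
  note gens = theta_diag_in_K_gens[OF assms this, THEN gen_in_ball,
      THEN theta_diag_power_in_ball[OF assms(1), where k = "nat \<bar>c\<bar>"]]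
  show ?thesis
  proof (cases "c \<ge> 0")
    case True
    with gens(1) show ?thesis by (simp add: power_int_def)
  next
    case False
    with gens(2) show ?thesis by (simp add: power_int_def)
  qed
qed

lemma theta_diag_prod_in_ball:
  assumes "r < n"
  shows "\<theta> n r r (\<Prod>p\<in>P. of_nat p powi c p) \<in> ball (\<Sum>p\<in>P. nat \<bar>c p\<bar>)"
proof -
  have "\<theta> n r r (\<Prod>p\<in>Q. of_nat p powi c p) \<in> ball (\<Sum>p\<in>Q. nat \<bar>c p\<bar>)"
    if "finite Q" "Q \<subseteq> P" for Q
    using that
  proof (induction Q)
    case empty
    then show ?case by (simp add: theta_diag_one one_in_ball)
  next
    case (insert p Q)
    then have "\<theta> n r r (of_nat p powi c p) * \<theta> n r r (\<Prod>p\<in>Q. of_nat p powi c p) \<in>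
        ball (nat \<bar>c p\<bar> + (\<Sum>p\<in>Q. nat \<bar>c p\<bar>))"
      by (intro mult_in_ball theta_diag_prime_in_ball assms) auto
    then show ?case using insert(1,2) by (simp add: theta_diag_mult[OF assms])
  qed
  then show ?thesis using finite_P by blast
qed

lemma theta_diag_b_in_ball:
  assumes "r < n"
  shows "\<theta> n r r (of_nat b) \<in> ball (card P)" "\<theta> n r r (inverse (of_nat b)) \<in> ball (card P)"
proof -
  have "(\<Prod>p\<in>P. (of_nat p :: rat) powi - 1) = inverse (of_nat b)"
    by (simp add: power_int_minus prod_inversef[symmetric] comp_def)
  then show "\<theta> n r r (inverse (of_nat b)) \<in> ball (card P)"
    using theta_diag_prod_in_ball[OF assms, of "\<lambda>_. -1"] by simp
  show "\<theta> n r r (of_nat b) \<in> ball (card P)"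
    using theta_diag_prod_in_ball[OF assms, of "\<lambda>_. 1"] by simp
qed

text \<open>The cost is linear in \<open>d\<close>, which is affordable because this is applied to
  single digits.\<close>

lemma theta_upper_multiple_in_ball:
  assumes "r < s" "s < n" "\<bar>q\<bar> = 1"
  shows "\<theta> n r s (of_nat d * q) \<in> ball d"
proof (induction d)
  case 0
  then show ?case using assms(1) by (simp add: theta_upper_zero one_in_ball)
next
  case (Suc d)
  from mult_in_ball[OF gen_in_ball[OF theta_in_K_gens[OF assms]] Suc] show ?case
    using assms by (simp add: theta_upper_mult algebra_simps)
qed

lemma theta_conjugate_in_ball:
  assumes "r < s" "s < n" "t \<noteq> 0"
    and "\<theta> n r r t \<in> ball k" "\<theta> n r r (inverse t) \<in> ball k" "\<theta> n r s x \<in> ball m"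
  shows "\<theta> n r s (t * x) \<in> ball (m + 2 * k)"
proof -
  have "\<theta> n r r t * (\<theta> n r s x * \<theta> n r r (inverse t)) \<in> ball (k + (m + k))"
    using assms by (intro mult_in_ball)
  moreover have "k + (m + k) = m + 2 * k" by simp
  ultimately show ?thesis using theta_conjugate[of r n s t x] assms(1-3) by simp
qed

text \<open>Horner's scheme: \<open>N = b * (N div b) + N mod b\<close>. Each digit costs one
  conjugation, \<open>2 * card P\<close>, plus at most \<open>b\<close> letters for the digit
  itself.\<close>

lemma theta_upper_nat_in_ball:
  assumes "r < s" "s < n" "\<bar>q\<bar> = 1" "N < b ^ m"
  shows "\<theta> n r s (of_nat N * q) \<in> ball (m * (2 * card P + b))"
  using assms(4)
proof (induction m arbitrary: N)
  case 0
  then show ?case using assms(1) by (simp add: theta_upper_zero one_in_ball)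
next
  case (Suc m)
  have "N div b < b ^ m" using Suc(2) by (simp add: less_mult_imp_div_less mult.commute)
  from Suc(1)[OF this] have
    "\<theta> n r s (of_nat b * (of_nat (N div b) * q)) \<in> ball (m * (2 * card P + b) + 2 * card P)"
    using assms(1,2) b_pos
    by (intro theta_conjugate_in_ball theta_diag_b_in_ball) (simp_all del: of_nat_prod)
  from mult_in_ball[OF this theta_upper_multiple_in_ball[OF assms(1-3), of "N mod b"]]
  have "\<theta> n r s (of_nat b * (of_nat (N div b) * q) + of_nat (N mod b) * q) \<in>
      ball (m * (2 * card P + b) + 2 * card P + N mod b)"
    using assms(1,2) by (simp add: theta_upper_mult)
  moreover have "of_nat b * (of_nat (N div b) * q) + of_nat (N mod b) * q = of_nat N * q"
  proof -
    have "of_nat b * (of_nat (N div b) * q) + of_nat (N mod b) * q =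
        of_nat (b * (N div b) + N mod b) * q"
      by (simp only: of_nat_add of_nat_mult distrib_right mult.assoc)
    then show ?thesis by simp
  qed
  moreover have "N mod b \<le> b" using b_pos by (intro less_imp_le mod_less_divisor)
  then have "m * (2 * card P + b) + 2 * card P + N mod b \<le> Suc m * (2 * card P + b)" by simp
  ultimately show ?case by (metis word_ball_mono)
qed

text \<open>With \<open>M\<close> the length of \<open>x\<close>, the integer
  \<open>x * b ^ M\<close> has at most \<open>2 * M + 1\<close> digits. It is built by Horner's
  scheme and then shifted down \<open>M\<close> places by conjugation, so the cost is linear in
  \<open>M\<close>.\<close>

lemma theta_upper_in_ball:
  assumes "r < s" "s < n" "base_bounded b m x"
  shows "\<theta> n r s x \<in> ball (nat (base_length b x) * (8 * card P + 3 * b))"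
proof (cases "x = 0")
  case True
  then show ?thesis using assms(1) by (simp add: theta_upper_zero one_in_ball)
next
  case False
  define M where "M = nat (base_length b x)"
  have "0 < M" unfolding M_def using base_length_pos[OF b_gt_1 assms(3) False] by simp
  define B where "B = (of_nat b :: rat)"
  have B: "1 < B" unfolding B_def using b_gt_1 by linarith
  have M: "x * B ^ M \<in> \<int>" "\<bar>x\<bar> \<le> B ^ M"
    using base_bounded_base_length[OF b_gt_1 assms(3)] unfolding M_def base_bounded_def B_def
    by auto
  have "\<bar>x * B ^ M\<bar> \<in> \<int>" using M(1) by (rule Ints_abs)
  then have "\<bar>x\<bar> * B ^ M \<in> \<nat>" using B by (simp add: Nats_altdef2 abs_mult)
  then obtain N where N: "\<bar>x\<bar> * B ^ M = of_nat N" by (elim Nats_cases)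
  have "(of_nat N :: rat) \<le> B ^ M * B ^ M"
    unfolding N[symmetric] using M(2) B by (intro mult_right_mono) auto
  also have "\<dots> < B ^ (2 * M + 1)" using B by (simp add: power_add mult_2)
  also have "\<dots> = of_nat (b ^ (2 * M + 1))" unfolding B_def by (simp only: of_nat_power)
  finally have "N < b ^ (2 * M + 1)" using of_nat_less_iff by blast
  \<comment> \<open>\<open>N\<close> comes from \<open>\<bar>x\<bar>\<close>, so the unit
    \<open>sgn x\<close> restores the sign.\<close>
  then have *: "\<theta> n r s (of_nat N * sgn x) \<in> ball ((2 * M + 1) * (2 * card P + b))"
    using assms(1,2) False by (intro theta_upper_nat_in_ball) (simp_all only: abs_sgn_eq if_False)
  have r: "r < n" using assms by simp
  have "\<theta> n r s (inverse B ^ M * (of_nat N * sgn x)) \<in>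
      ball ((2 * M + 1) * (2 * card P + b) + 2 * (M * card P))"
  proof (rule theta_conjugate_in_ball[OF assms(1,2) _ _ _ *])
    show "inverse B ^ M \<noteq> 0" using B by simp
    show "\<theta> n r r (inverse B ^ M) \<in> ball (M * card P)"
      unfolding B_def by (intro theta_diag_power_in_ball theta_diag_b_in_ball r)
    have "\<theta> n r r (B ^ M) \<in> ball (M * card P)"
      unfolding B_def by (intro theta_diag_power_in_ball theta_diag_b_in_ball r)
    then show "\<theta> n r r (inverse (inverse B ^ M)) \<in> ball (M * card P)"
      by (simp add: power_inverse)
  qed
  moreover have "inverse B ^ M * (of_nat N * sgn x) = x"
  proof -
    have "inverse B ^ M * (of_nat N * sgn x) = (inverse B * B) ^ M * (\<bar>x\<bar> * sgn x)"
      unfolding N[symmetric] power_mult_distrib by (simp only: ac_simps)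
    then show ?thesis using B by (simp add: abs_mult_sgn)
  qed
  \<comment> \<open>As \<open>M\<close> is positive, \<open>2 * M + 1 \<le> 3 * M\<close>; this is
    where the constant \<open>8 * card P + 3 * b\<close> comes from.\<close>
  moreover have "(2 * M + 1) * (2 * card P + b) + 2 * (M * card P) \<le> M * (8 * card P + 3 * b)"
  proof -
    have "(2 * M + 1) * (2 * card P + b) \<le> (3 * M) * (2 * card P + b)"
      using \<open>0 < M\<close> by (intro mult_right_mono) auto
    then show ?thesis by (simp add: algebra_simps)
  qed
  ultimately show ?thesis
    unfolding M_def[symmetric] by (intro word_ball_mono[OF \<open>_ \<le> M * (8 * card P + 3 * b)\<close>]) simp
qed

section \<open>Factorisation of upper triangular matrices in column order\<close>

text \<open>For upper triangular \<open>f\<close> and \<open>i \<le> Suc k\<close>, this is the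
  partial product after all factors of the columns before \<open>k\<close> and the first
  \<open>i\<close> factors of column \<open>k\<close>, the newest on the left.\<close>

definition column_prefix :: "rat mat \<Rightarrow> nat \<Rightarrow> nat \<Rightarrow> rat mat" where
  "column_prefix f k i =
     mat n n (\<lambda>(a, c). if c < k \<or> c = k \<and> a < i then f $$ (a, c) else if a = c then 1 else 0)"

lemma column_prefix_index:
  "a < n \<Longrightarrow> c < n \<Longrightarrow> column_prefix f k i $$ (a, c) =
    (if c < k \<or> c = k \<and> a < i then f $$ (a, c) else if a = c then 1 else 0)"
  by (simp add: column_prefix_def)

lemma column_prefix_carrier: "column_prefix f k i \<in> carrier_mat n n"
  by (simp add: column_prefix_def)

lemma column_prefix_dim: "dim_row (column_prefix f k i) = n" "dim_col (column_prefix f k i) = n"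
  by (simp_all add: column_prefix_def)

text \<open>
  As \<open>f\<close> is upper triangular, row \<open>k\<close> of the prefix is still the \<open>k\<close>-th unit row, so the row
  operation \<open>\<theta> n i k q\<close> changes nothing but the entry \<open>(i, k)\<close>.
\<close>

lemma column_prefix_Suc:
  assumes "\<And>i j. i < n \<Longrightarrow> j < i \<Longrightarrow> f $$ (i, j) = 0" "k < n" "i \<le> k"
  shows "column_prefix f k (Suc i) = \<theta> n i k (f $$ (i, k)) * column_prefix f k i"
proof (rule eq_matI)
  fix a c assume "a < dim_row (\<theta> n i k (f $$ (i, k)) * column_prefix f k i)"
    "c < dim_col (\<theta> n i k (f $$ (i, k)) * column_prefix f k i)"
  then have ac: "a < n" "c < n" by (simp_all add: column_prefix_dim)
  have i: "i < n" using assms by simp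
  show "column_prefix f k (Suc i) $$ (a, c) =
      (\<theta> n i k (f $$ (i, k)) * column_prefix f k i) $$ (a, c)"
    unfolding theta_mult_index[OF column_prefix_carrier ac assms(2)]
    using ac i assms by (auto simp: column_prefix_index less_Suc_eq)
qed (simp_all add: column_prefix_dim)

text \<open>Below the diagonal, column \<open>k\<close> of \<open>f\<close> agrees with the
  identity, so \<open>k + 1\<close> factors complete it.\<close>

lemma column_prefix_next:
  assumes "\<And>i j. i < n \<Longrightarrow> j < i \<Longrightarrow> f $$ (i, j) = 0"
  shows "column_prefix f (Suc k) 0 = column_prefix f k (Suc k)"
  by (rule eq_matI) (auto simp: column_prefix_index column_prefix_dim less_Suc_eq assms)

text \<open>An inner induction completes one column, an outer one runs through the columns; each
  factor adds its own cost \<open>w i j\<close>.\<close>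

lemma upper_triangular_in_ball:
  assumes "f \<in> carrier_mat n n" "\<And>i j. i < n \<Longrightarrow> j < i \<Longrightarrow> f $$ (i, j) = 0"
    and w: "\<And>i j. i \<le> j \<Longrightarrow> j < n \<Longrightarrow> \<theta> n i j (f $$ (i, j)) \<in> ball (w i j)"
  shows "f \<in> ball (\<Sum>j<n. \<Sum>i<Suc j. w i j)"
proof -
  have column: "column_prefix f k i \<in> ball (c + (\<Sum>i<i. w i k))"
    if "column_prefix f k 0 \<in> ball c" "k < n" "i \<le> Suc k" for k i c
    using that(3)
  proof (induction i)
    case 0
    then show ?case using that(1) by simp
  next
    case (Suc i)
    then have "\<theta> n i k (f $$ (i, k)) * column_prefix f k i \<in> ball (w i k + (c + (\<Sum>i<i. w i k)))"
      using w[of i k] that(2) by (intro mult_in_ball) auto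
    moreover have "column_prefix f k (Suc i) = \<theta> n i k (f $$ (i, k)) * column_prefix f k i"
      using Suc(2) that(2) by (intro column_prefix_Suc assms(2)) auto
    ultimately show ?case by (simp add: ac_simps)
  qed
  have "column_prefix f k 0 \<in> ball (\<Sum>j<k. \<Sum>i<Suc j. w i j)" if "k \<le> n" for k
    using that
  proof (induction k)
    case 0
    have "column_prefix f 0 0 = 1\<^sub>m n"
      by (rule eq_matI) (auto simp: column_prefix_index column_prefix_dim)
    then show ?case by (simp add: one_in_ball)
  next
    case (Suc k)
    then show ?case
      using column[of k "\<Sum>j<k. \<Sum>i<Suc j. w i j" "Suc k"]
      by (simp only: column_prefix_next[OF assms(2)] sum.lessThan_Suc Suc_le_eq less_imp_le)
  qed
  moreover have "column_prefix f n 0 = f"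
    by (rule eq_matI) (use assms(1) in \<open>auto simp: column_prefix_index column_prefix_dim\<close>)
  ultimately show ?thesis by (metis order_refl)
qed

section \<open>Upper bound and conclusion\<close>

lemma word_length_le_estimate:
  assumes "f \<in> ball m"
  shows "int (word_length (GL_rat n) (K_gens n P) f) \<le>
    (1 + int (8 * card P + 3 * b)) * FG_estimate n P f"
proof -
  define C where "C = 8 * card P + 3 * b"
  note f = word_bounds_ball[OF assms, unfolded word_bounds_def]
  obtain c where c: "\<forall>i p. p \<notin> P \<longrightarrow> c i p = 0"
    "\<forall>i<n. f $$ (i, i) = (\<Prod>p\<in>P. of_nat p powi c i p)"
    using f by blast
  have exps: "prime_exponents P (f $$ (i, i)) = c i" if "i < n" for i
    using c that prime_exponents_eq[OF finite_P prime_P, of "c i"] by simp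
  have bounded: "base_bounded b m (f $$ (i, j))" if "i < j" "j < n" for i j
    using f that by auto
  define w where "w i j = (if i = j then \<Sum>p\<in>P. nat \<bar>c i p\<bar>
      else nat (base_length b (f $$ (i, j))) * C)" for i j
  have entry: "\<theta> n i j (f $$ (i, j)) \<in> ball (w i j)" if "i \<le> j" "j < n" for i j
  proof (cases "i = j")
    case True
    have "f $$ (j, j) = (\<Prod>p\<in>P. of_nat p powi c j p)" using c(2) that(2) by blast
    with theta_diag_prod_in_ball[OF that(2), of "c j"] True show ?thesis
      by (simp only: w_def simp_thms if_True)
  next
    case False
    with that have "i < j" by simp
    from theta_upper_in_ball[OF this that(2) bounded[OF this that(2)]] False show ?thesis
      by (simp only: w_def C_def if_False)
  qed
  have "f \<in> carrier_mat n n" using f by blast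
  moreover have "f $$ (i, j) = 0" if "i < n" "j < i" for i j using f that by blast
  ultimately have "f \<in> ball (\<Sum>j<n. \<Sum>i<Suc j. w i j)"
    using entry by (rule upper_triangular_in_ball)
  then have "word_length (GL_rat n) (K_gens n P) f \<le> (\<Sum>j<n. \<Sum>i<Suc j. w i j)"
    by (rule word_length_le)
  moreover have "int (\<Sum>j<n. \<Sum>i<Suc j. w i j) \<le> (1 + int C) * FG_estimate n P f"
  proof -
    define D where "D = (\<Sum>i<n. \<Sum>p\<in>P. \<bar>c i p\<bar>)"
    define E where "E = (\<Sum>i<n - 1. \<Sum>j\<in>{i + 1..<n}. base_length b (f $$ (i, j)))"
    have DE: "FG_estimate n P f = D + E"
      unfolding FG_estimate_def D_def E_def using exps by simp
    \<comment> \<open>The factorisation is summed by columns, the estimate by rows. The case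
      \<open>n = 0\<close> is separate because \<open>n - 1\<close> truncates.\<close>
    have swap: "(\<Sum>j<n. \<Sum>i<j. a j i) = (\<Sum>i<n - 1. \<Sum>j\<in>{i + 1..<n}. a j i)"
      for a :: "nat \<Rightarrow> nat \<Rightarrow> int"
    proof (cases n)
      case (Suc k)
      then show ?thesis
        using sum.nested_swap'[of a k]
        by (simp only: lessThan_Suc_atMost atLeastLessThanSuc_atLeastAtMost Suc_eq_plus1[symmetric]
            diff_Suc_1)
    qed simp
    have pos: "0 \<le> base_length b (f $$ (i, j))" if "i < j" "j < n" for i j
    proof (cases "f $$ (i, j) = 0")
      case False
      then show ?thesis using base_length_pos[OF b_gt_1 bounded[OF that]] by simp
    qed (simp add: base_length_def)
    have w_less: "int (w i j) = base_length b (f $$ (i, j)) * int C" if "i < j" "j < n" for i j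
      using that pos[OF that] by (simp add: w_def del: of_nat_prod)
    have w_eq: "int (w j j) = (\<Sum>p\<in>P. \<bar>c j p\<bar>)" for j
      by (simp add: w_def)
    have "int (\<Sum>j<n. \<Sum>i<Suc j. w i j) = (\<Sum>j<n. (\<Sum>i<j. int (w i j)) + int (w j j))"
      by (simp only: of_nat_sum sum.lessThan_Suc of_nat_add)
    also have "\<dots> = (\<Sum>j<n. (\<Sum>i<j. base_length b (f $$ (i, j)) * int C) + (\<Sum>p\<in>P. \<bar>c j p\<bar>))"
      using w_less w_eq by (intro sum.cong refl arg_cong2[where f = "(+)"]) auto
    also have "\<dots> = (\<Sum>j<n. \<Sum>i<j. base_length b (f $$ (i, j))) * int C + D"
      unfolding D_def sum.distrib sum_distrib_right ..
    also have "\<dots> = E * int C + D"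
      unfolding E_def swap ..
    \<comment> \<open>Both parts are nonnegative, so \<open>1 + C\<close> dominates the coefficient
      1 of \<open>D\<close> and the coefficient \<open>C\<close> of \<open>E\<close>.\<close>
    also have "\<dots> \<le> (1 + int C) * (D + E)"
    proof -
      have "0 \<le> D" unfolding D_def by (intro sum_nonneg) auto
      moreover have "0 \<le> E" unfolding E_def by (intro sum_nonneg pos) auto
      ultimately show ?thesis by (simp add: algebra_simps)
    qed
    finally show ?thesis unfolding DE .
  qed
  ultimately show ?thesis unfolding C_def by linarith
qed

end

theorem proposition3p0p6:
  fixes n :: nat and P :: "nat set"
  assumes "finite P" and "P \<noteq> {}" and "\<And>p. p \<in> P \<Longrightarrow> prime p"
  shows "\<exists>J::real. 0 < J \<and>
    (\<forall>f\<in>FG n P.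
       1 / J * of_int (FG_estimate n P f) \<le> of_nat (word_length (GL_rat n) (K_gens n P) f) \<and>
       of_nat (word_length (GL_rat n) (K_gens n P) f) \<le> J * of_int (FG_estimate n P f))"
proof -
  interpret prime_base n P by unfold_locales (use assms in auto)
  \<comment> \<open>These are the constants of the two one-sided bounds; both are positive, so their
    sum serves for both.\<close>
  define A B :: int where "A = 1 + 2 * int n * int n" and "B = 1 + int (8 * card P + 3 * b)"
  define J where "J = A + B"
  have "0 < B" unfolding B_def by (rule add_pos_nonneg[OF _ of_nat_0_le_iff]) simp
  moreover have "0 < A" unfolding A_def by (intro add_pos_nonneg) simp_all
  ultimately have J: "0 < J" "A \<le> J" "B \<le> J" unfolding J_def by simp_all
  have "FG_estimate n P f \<le> J * int (word_length (GL_rat n) (K_gens n P) f) \<and>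
      int (word_length (GL_rat n) (K_gens n P) f) \<le> J * FG_estimate n P f"
    if "f \<in> FG n P" for f
  proof -
    define l where "l = word_length (GL_rat n) (K_gens n P) f"
    have f: "f \<in> ball l"
      unfolding l_def using that group.in_word_ball_word_length[OF group_GL_rat
          K_gens_carrier[OF zero_notin_P]] unfolding FG_def by blast
    have "FG_estimate n P f \<le> A * int l" unfolding A_def by (rule estimate_le[OF f])
    also have "\<dots> \<le> J * int l" using J(2) by (intro mult_right_mono) simp_all
    finally have 1: "FG_estimate n P f \<le> J * int l" .
    have 2: "int l \<le> B * FG_estimate n P f"
      unfolding l_def B_def by (rule word_length_le_estimate[OF f])
    \<comment> \<open>Nonnegativity of the estimate, needed to enlarge \<open>B\<close> to
      \<open>J\<close>, is read off from the bound on the nonnegative word length.\<close>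
    then have "0 \<le> B * FG_estimate n P f" by linarith
    with \<open>0 < B\<close> have "0 \<le> FG_estimate n P f" by (simp add: zero_le_mult_iff)
    with J(3) have "B * FG_estimate n P f \<le> J * FG_estimate n P f" by (intro mult_right_mono)
    with 1 2 show ?thesis unfolding l_def by linarith
  qed
  then have "real_of_int (FG_estimate n P f) \<le>
      of_int (J * int (word_length (GL_rat n) (K_gens n P) f))"
    "real_of_int (int (word_length (GL_rat n) (K_gens n P) f)) \<le> of_int (J * FG_estimate n P f)"
    if "f \<in> FG n P" for f
    using that by (simp_all only: of_int_le_iff)
  then have ineqs: "real_of_int (FG_estimate n P f) \<le>
      of_int J * real (word_length (GL_rat n) (K_gens n P) f)"
    "real (word_length (GL_rat n) (K_gens n P) f) \<le> of_int J * of_int (FG_estimate n P f)"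
    if "f \<in> FG n P" for f
    using that by (simp_all only: of_int_mult of_int_of_nat_eq)
  have "0 < real_of_int J" using J(1) by simp
  with ineqs show ?thesis
    by (intro exI[of _ "real_of_int J"]) (simp add: pos_divide_le_eq mult.commute)
qed

end
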